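(* For every $p\in[0,1]$ there is an infinite sequence of edge-weighted bipartite graphs $G_1,G_2,\dots$ with increasing number of vertices such that the competitive-ratio $\mathrm{E}[\mathrm{ALG}(G_k)]/\mathrm{OPT}(G_k)$ of the greedy-based algorithm with parameter $p$ on $G_k$ approaches $\frac{p(1-p)}{1+p}$ as $k\to\infty$. Furthermore, this is true for any arrival order of the vertices in $L\setminus L'$ (the vertices arriving after the sampling phase).
   Context: Setting (random-order online weighted bipartite matching with one-sided vertex arrivals). A finite bipartite graph $G=(L,R,E)$ has weights $w:E\to\mathbb{R}_{\ge0}$; ties between weights are broken by a fixed consistent rule, so edge weights are totally ordered. $\mathrm{OPT}(G)$ is the maximum weight of a matching in $G$. For $U\subseteq L$, $G[U]$ denotes the subgraph induced on $U\cup R$. $\mathrm{Greedy}(H)$: process the edges of $H$ in non-increasing order of weight, adding an edge to the matching iff neither of its endpoints is already covered. Greedy-based algorithm with parameter $p$: (1) draw $k\sim\mathrm{Binom}(|L|,p)$ and let $L'$ be the first $k$ vertices in a uniformly random arrival order of $L$ (sampling phase; equivalently each vertex of $L$ is in $L'$ independently with probability $p$); set $M=\emptyset$. (2) When a later vertex $u\in L\setminus L'$ arrives, compute $\mathrm{Greedy}(G[L'\cup\{u\}])$; if $u$ is matched in it by an edge $(u,r)$ and $r$ is not yet matched in $M$, add $(u,r)$ to $M$. Output $M$. $\mathrm{ALG}(G)$ denotes the weight of the output matching. The arrival order of $L\setminus L'$ may be arbitrary, possibly depending on $L'$. *)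

theory Defs
  imports "HOL-Probability.Probability"
begin

text \<open>
  The two sides carry separate vertex types and an edge is a pair (left endpoint, right endpoint),
  so bipartiteness and the disjointness of the two sides are built in.
\<close>

record ('l, 'r) wgraph =
  left :: "'l set"
  right :: "'r set"
  edges :: "('l \<times> 'r) set"
  weight :: "'l \<times> 'r \<Rightarrow> real"

definition wf_wgraph :: "('l, 'r) wgraph \<Rightarrow> bool" where
  "wf_wgraph G \<longleftrightarrow> finite (left G) \<and> finite (right G) \<and>
     edges G \<subseteq> left G \<times> right G \<and> (\<forall>e\<in>edges G. 0 \<le> weight G e)"

definition num_vertices :: "('l, 'r) wgraph \<Rightarrow> nat" where
  "num_vertices G = card (left G) + card (right G)"

definition induced :: "('l, 'r) wgraph \<Rightarrow> 'l set \<Rightarrow> ('l, 'r) wgraph" where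
  "induced G U = G\<lparr>left := left G \<inter> U, edges := {e \<in> edges G. fst e \<in> U}\<rparr>"

definition matching :: "('l, 'r) wgraph \<Rightarrow> ('l \<times> 'r) set \<Rightarrow> bool" where
  "matching G M \<longleftrightarrow> M \<subseteq> edges G \<and> inj_on fst M \<and> inj_on snd M"

definition opt :: "('l, 'r) wgraph \<Rightarrow> real" where
  "opt G = Max ((\<lambda>M. \<Sum>e\<in>M. weight G e) ` {M. matching G M})"

text \<open>
  A tie-breaking rule is represented by the total order of the edges that it induces: an
  enumeration of all edges in non-increasing order of weight. Consistency means that the same
  enumeration is used for every induced subgraph.
\<close>

definition edge_order :: "('l, 'r) wgraph \<Rightarrow> ('l \<times> 'r) list \<Rightarrow> bool" where
  "edge_order G es \<longleftrightarrow> distinct es \<and> set es = edges G \<and>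
     sorted_wrt (\<lambda>e f. weight G e \<ge> weight G f) es"

definition greedy_step :: "'l \<times> 'r \<Rightarrow> ('l \<times> 'r) set \<Rightarrow> ('l \<times> 'r) set" where
  "greedy_step e M = (if fst e \<in> fst ` M \<or> snd e \<in> snd ` M then M else insert e M)"

text \<open>Here \<open>H\<close> is a subgraph of the graph whose edges are enumerated by \<open>es\<close>.\<close>

definition greedy :: "('l \<times> 'r) list \<Rightarrow> ('l, 'r) wgraph \<Rightarrow> ('l \<times> 'r) set" where
  "greedy es H = fold greedy_step (filter (\<lambda>e. e \<in> edges H) es) {}"

text \<open>
  Arrival of \<open>u\<close> when the sample is \<open>S\<close> and the current matching is \<open>M\<close>. The greedy matching has at
  most one edge at \<open>u\<close>, so at most one edge is added.
\<close>

definition alg_step ::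
  "('l, 'r) wgraph \<Rightarrow> ('l \<times> 'r) list \<Rightarrow> 'l set \<Rightarrow> 'l \<Rightarrow> ('l \<times> 'r) set \<Rightarrow> ('l \<times> 'r) set" where
  "alg_step G es S u M =
     M \<union> {(u, r) | r. (u, r) \<in> greedy es (induced G (S \<union> {u})) \<and> r \<notin> snd ` M}"

definition alg_output ::
  "('l, 'r) wgraph \<Rightarrow> ('l \<times> 'r) list \<Rightarrow> 'l set \<Rightarrow> 'l list \<Rightarrow> ('l \<times> 'r) set" where
  "alg_output G es S vs = fold (alg_step G es S) vs {}"

definition alg_value ::
  "('l, 'r) wgraph \<Rightarrow> ('l \<times> 'r) list \<Rightarrow> 'l set \<Rightarrow> 'l list \<Rightarrow> real" where
  "alg_value G es S vs = (\<Sum>e\<in>alg_output G es S vs. weight G e)"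

text \<open>
  Joint distribution of the sample and of the sequence of the remaining left vertices: first in the
  uniformly random order model, then with the remaining vertices arriving in an order chosen by an
  adversary who knows the sample. The adversary may randomise; a deterministic order is the case
  where \<open>\<sigma> S\<close> is a point mass.
\<close>

definition random_arrivals :: "real \<Rightarrow> 'l set \<Rightarrow> ('l set \<times> 'l list) pmf" where
  "random_arrivals p A =
     bind_pmf (binomial_pmf (card A) p) (\<lambda>k.
     bind_pmf (pmf_of_set (permutations_of_set A)) (\<lambda>vs.
     return_pmf (set (take k vs), drop k vs)))"

definition adversarial_arrivals ::
  "real \<Rightarrow> 'l set \<Rightarrow> ('l set \<Rightarrow> 'l list pmf) \<Rightarrow> ('l set \<times> 'l list) pmf" where
  "adversarial_arrivals p A \<sigma> =
     bind_pmf (map_pmf fst (random_arrivals p A)) (\<lambda>S.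
     bind_pmf (\<sigma> S) (\<lambda>vs.
     return_pmf (S, vs)))"

definition arrival_rule :: "'l set \<Rightarrow> ('l set \<Rightarrow> 'l list pmf) \<Rightarrow> bool" where
  "arrival_rule A \<sigma> \<longleftrightarrow> (\<forall>S. S \<subseteq> A \<longrightarrow> set_pmf (\<sigma> S) \<subseteq> permutations_of_set (A - S))"

definition expected_alg ::
  "('l, 'r) wgraph \<Rightarrow> ('l \<times> 'r) list \<Rightarrow> ('l set \<times> 'l list) pmf \<Rightarrow> real" where
  "expected_alg G es D = measure_pmf.expectation D (\<lambda>(S, vs). alg_value G es S vs)"

end

theory Submission
  imports Defs "HOL-Real_Asymp.Real_Asymp"
begin

text \<open>
  Let left vertex \<open>j\<close> be adjacent to the right vertices \<open>i \<le> j\<close>, with all weights almost equal to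
  \<open>1\<close>, smaller \<open>i\<close> being preferred first and then larger \<open>j\<close>. Greedy on a set \<open>U\<close> matches the
  element of \<open>U\<close> that has exactly \<open>i\<close> larger elements in \<open>U\<close> to \<open>i\<close>, as long as this is an edge.
  Given the sample \<open>S\<close>, an unsampled \<open>u\<close> therefore competes for the number \<open>r\<close> of larger sampled
  vertices, provided that \<open>r \<le> u\<close>. Whoever wins a contested right vertex, the number of matched
  ones depends on \<open>S\<close> only.

  The vertices \<open>u\<close> with at most \<open>u\<close> larger sampled vertices form an interval from a random \<open>T\<close> to
  \<open>n - 1\<close>, and up to one it contains \<open>T\<close> sampled vertices. Whether \<open>u\<close> lies in it is independent of
  whether \<open>u\<close> is sampled, so its expected length \<open>N\<close> satisfies \<open>p N + N = n + O(1)\<close>. A right vertex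
  is gained for each unsampled \<open>u\<close> in the interval whose successor is sampled, and conditioning on
  the vertices above \<open>u\<close> shows that the expected number of these is
  \<open>(1 - p) (p N + O(1)) = p (1 - p) n / (1 + p) + O(1)\<close>.
\<close>

section \<open>Certifying a greedy matching\<close>

text \<open>Edges of \<open>M\<close> never block one another, and every other edge of
  \<open>H\<close> meets a strictly heavier edge of \<open>M\<close>, which is processed earlier
  under any tie-breaking rule.\<close>

lemma greedy_eqI:
  assumes es: "edge_order G es" and H: "edges H \<subseteq> edges G"
    and M: "matching H M"
    and stable: "\<And>e. e \<in> edges H - M \<Longrightarrow>
      \<exists>f\<in>M. (fst f = fst e \<or> snd f = snd e) \<and> weight G e < weight G f"
  shows "greedy es H = M"
proof -
  have sub: "M \<subseteq> edges H" and inj: "inj_on fst M" "inj_on snd M"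
    using M by (auto simp: matching_def)
  \<comment> \<open>The remainder \<open>ys\<close> is kept because its edges are no heavier than
    the current one, so a strictly heavier blocker must lie in the prefix already processed.\<close>
  have "fold greedy_step (filter (\<lambda>e. e \<in> edges H) xs) {} = M \<inter> set xs"
    if "es = xs @ ys" for xs ys
    using that
  proof (induction xs arbitrary: ys rule: rev_induct)
    case Nil
    then show ?case by simp
  next
    case (snoc e xs)
    have IH: "fold greedy_step (filter (\<lambda>e. e \<in> edges H) xs) {} = M \<inter> set xs"
      using snoc.IH[of "e # ys"] snoc.prems by simp
    have e: "e \<notin> set xs" and ys: "\<And>f. f \<in> set ys \<Longrightarrow> weight G f \<le> weight G e"
      using es snoc.prems by (auto simp: edge_order_def sorted_wrt_append)
    have cov: "set es = edges G" using es by (simp add: edge_order_def)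
    consider "e \<notin> edges H" | "e \<in> M" | "e \<in> edges H - M" by blast
    then show ?case
    proof cases
      case 1
      then show ?thesis using IH sub by auto
    next
      case 2
      have "fst e \<notin> fst ` (M \<inter> set xs)" "snd e \<notin> snd ` (M \<inter> set xs)"
        using 2 e inj by (auto dest: inj_onD)
      then have "greedy_step e (M \<inter> set xs) = insert e (M \<inter> set xs)"
        unfolding greedy_step_def by simp
      then show ?thesis using 2 IH sub by auto
    next
      case 3
      then obtain f where f: "f \<in> M" "fst f = fst e \<or> snd f = snd e" "weight G e < weight G f"
        using stable by blast
      have "f \<in> set es" using f(1) sub H cov by blast
      moreover have "f \<noteq> e" "f \<notin> set ys" using ys[of f] f(3) by auto
      ultimately have "f \<in> set xs" using snoc.prems by simp
      then have "fst e \<in> fst ` (M \<inter> set xs) \<or> snd e \<in> snd ` (M \<inter> set xs)"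
        using f(1,2) by (metis IntI imageI)
      then have "greedy_step e (M \<inter> set xs) = M \<inter> set xs"
        unfolding greedy_step_def by (rule if_P)
      then show ?thesis using 3 IH by auto
    qed
  qed
  from this[of es "[]"] show ?thesis
    using es sub H by (auto simp: greedy_def edge_order_def)
qed

section \<open>Ranks in a finite set of vertices\<close>

definition sample_rank :: "nat set \<Rightarrow> nat \<Rightarrow> nat" where
  "sample_rank U u = card {s \<in> U. u < s}"

lemma sample_rank_less:
  assumes "finite U" "v \<in> U" "u < v"
  shows "sample_rank U v < sample_rank U u"
  unfolding sample_rank_def using assms by (intro psubset_card_mono) auto

lemma sample_rank_mono: "finite U \<Longrightarrow> u \<le> v \<Longrightarrow> sample_rank U v \<le> sample_rank U u"
  unfolding sample_rank_def by (intro card_mono) auto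

lemma inj_on_rank: "finite U \<Longrightarrow> inj_on (sample_rank U) U"
  by (rule linorder_inj_onI) (metis sample_rank_less nat_neq_iff, auto)

text \<open>Ranks are distinct and below \<open>card U\<close>, so counting leaves no gap. This
  later supplies an element of a prescribed rank.\<close>

lemma sample_rank_image:
  assumes "finite U"
  shows "sample_rank U ` U = {..<card U}"
proof (rule card_subset_eq)
  show "sample_rank U ` U \<subseteq> {..<card U}"
    using assms by (auto simp: sample_rank_def intro!: psubset_card_mono)
  show "card (sample_rank U ` U) = card {..<card U}"
    using assms by (simp add: card_image inj_on_rank)
qed simp

lemma sample_rank_insert_self [simp]: "sample_rank (insert u U) u = sample_rank U u"
  unfolding sample_rank_def by (rule arg_cong[where f = card]) auto

lemma sample_rank_Suc:
  assumes "finite U"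
  shows "sample_rank U u = sample_rank U (Suc u) + of_bool (Suc u \<in> U)"
proof -
  have "{s \<in> U. u < s} = {s \<in> U. Suc u < s} \<union> (if Suc u \<in> U then {Suc u} else {})"
    by (auto intro: Suc_lessI)
  then show ?thesis using assms by (simp add: sample_rank_def)
qed

section \<open>The almost unweighted triangular graph\<close>

text \<open>
  The numerator orders the edges lexicographically, by decreasing \<open>i\<close> and then by increasing \<open>j\<close>.
\<close>

definition tri_graph :: "nat \<Rightarrow> (nat, nat) wgraph" where
  "tri_graph n = \<lparr>left = {..<n}, right = {..<n}, edges = {(j, i). i \<le> j \<and> j < n},
     weight = (\<lambda>(j, i). 1 + (real j + real n * (real n - real i)) / (real n + 1) ^ 3)\<rparr>"

lemma tri_graph_simps [simp]:
  "left (tri_graph n) = {..<n}" "right (tri_graph n) = {..<n}"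
  "edges (tri_graph n) = {(j, i). i \<le> j \<and> j < n}"
  by (simp_all add: tri_graph_def)

text \<open>On edges the numerator is at most \<open>(n + 1)^2\<close>, hence the cube in the
  denominator.\<close>

lemma weight_tri_graph:
  assumes "e \<in> edges (tri_graph n)"
  shows "1 \<le> weight (tri_graph n) e" "weight (tri_graph n) e \<le> 1 + 1 / (real n + 1)"
proof -
  obtain j i where e: "e = (j, i)" "i \<le> j" "j < n" using assms by auto
  have nonneg: "0 \<le> real n * (real n - real i)" using e by simp
  then show "1 \<le> weight (tri_graph n) e" by (simp add: tri_graph_def e)
  have "real n * (real n - real i) \<le> real n * real n" by (intro mult_left_mono) auto
  moreover have "(real n + 1) ^ 2 = real n * real n + (2 * real n + 1)"
    by (simp add: power2_eq_square algebra_simps)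
  ultimately have "real j + real n * (real n - real i) \<le> (real n + 1) ^ 2"
    using e by linarith
  then have "(real j + real n * (real n - real i)) / (real n + 1) ^ 3 \<le> (real n + 1) ^ 2 / (real n + 1) ^ 3"
    by (intro divide_right_mono) auto
  also have "\<dots> = 1 / (real n + 1)" by (simp add: power2_eq_square power3_eq_cube)
  finally show "weight (tri_graph n) e \<le> 1 + 1 / (real n + 1)" by (simp add: tri_graph_def e)
qed

text \<open>Lowering \<open>i\<close> by one raises the numerator by \<open>n\<close>, which
  outweighs any change of \<open>j\<close> below \<open>n\<close>. Distinct edges thus have distinct
  weights.\<close>

lemma weight_tri_graph_less:
  assumes "j < n" "j' < n" "i' < i \<or> i' = i \<and> j < j'"
  shows "weight (tri_graph n) (j, i) < weight (tri_graph n) (j', i')"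
proof -
  have "real j + real n * (real n - real i) < real j' + real n * (real n - real i')"
  proof (cases "i' = i")
    case False
    then have "real n * (1 + real i') \<le> real n * real i" using assms by (intro mult_left_mono) auto
    then show ?thesis using assms(1) by (simp add: algebra_simps)
  qed (use assms in auto)
  then show ?thesis by (simp add: tri_graph_def divide_strict_right_mono)
qed

lemma wf_tri_graph: "wf_wgraph (tri_graph n)"
  unfolding wf_wgraph_def using weight_tri_graph(1)[of _ n]
  by (auto intro: order_trans[OF zero_le_one])

lemma finite_edges_tri_graph: "finite {(j, i). i \<le> j \<and> j < (n::nat)}"
  by (rule finite_subset[of _ "{..<n} \<times> {..<n}"]) auto

text \<open>At most \<open>n\<close> edges, each with excess at most \<open>1 / (n + 1)\<close> over
  \<open>1\<close>, have total excess below \<open>1\<close>; weights can be traded for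
  cardinalities.\<close>

lemma weight_sum_tri_graph:
  assumes "M \<subseteq> edges (tri_graph n)" "inj_on snd M"
  shows "real (card M) \<le> (\<Sum>e\<in>M. weight (tri_graph n) e)"
    "(\<Sum>e\<in>M. weight (tri_graph n) e) \<le> real (card M) + 1" "card M \<le> n"
proof -
  show "real (card M) \<le> (\<Sum>e\<in>M. weight (tri_graph n) e)"
    unfolding real_of_card
    by (intro sum_mono weight_tri_graph(1) subsetD[OF assms(1)])
  have "card M = card (snd ` M)" using assms(2) by (simp add: card_image)
  also have "\<dots> \<le> card {..<n}" using assms(1) by (intro card_mono) auto
  finally show n: "card M \<le> n" by simp
  have "(\<Sum>e\<in>M. weight (tri_graph n) e) \<le> real (card M) * (1 + 1 / (real n + 1))"
    by (intro sum_bounded_above weight_tri_graph(2) subsetD[OF assms(1)])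
  also have "\<dots> = real (card M) + real (card M) / (real n + 1)" by (simp add: algebra_simps)
  also have "\<dots> \<le> real (card M) + 1" using n by simp
  finally show "(\<Sum>e\<in>M. weight (tri_graph n) e) \<le> real (card M) + 1" .
qed

lemma opt_tri_graph: "real n \<le> opt (tri_graph n)" "opt (tri_graph n) \<le> real n + 1"
proof -
  let ?w = "\<lambda>M. \<Sum>e\<in>M. weight (tri_graph n) e"
  have fin: "finite {M. matching (tri_graph n) M}"
    by (rule finite_subset[of _ "Pow {(j, i). i \<le> j \<and> j < n}"])
      (auto simp: matching_def finite_edges_tri_graph)
  \<comment> \<open>The diagonal is a perfect matching.\<close>
  define D where "D = (\<lambda>i. (i, i)) ` {..<n}"
  have D: "matching (tri_graph n) D" "card D = n"
    by (auto simp: D_def matching_def inj_on_def card_image)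
  have "real n \<le> ?w D" using D weight_sum_tri_graph(1)[of D n] by (simp add: matching_def)
  also have "\<dots> \<le> opt (tri_graph n)"
    unfolding opt_def using fin D(1) by (intro Max_ge) auto
  finally show "real n \<le> opt (tri_graph n)" .
  have "?w M \<le> real n + 1" if "matching (tri_graph n) M" for M
    using weight_sum_tri_graph(2)[of M n] weight_sum_tri_graph(3)[of M n] that
    unfolding matching_def by linarith
  then show "opt (tri_graph n) \<le> real n + 1"
    unfolding opt_def using fin D(1) by (subst Max_le_iff) auto
qed

section \<open>Greedy and the algorithm on this graph\<close>

lemma greedy_tri_graph:
  assumes es: "edge_order (tri_graph n) es" and U: "U \<subseteq> {..<n}"
  shows "greedy es (induced (tri_graph n) U) = {(u, sample_rank U u) |u. u \<in> U \<and> sample_rank U u \<le> u}"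
    (is "_ = ?M")
proof (rule greedy_eqI[OF es])
  have fin: "finite U" using U finite_subset by blast
  have H: "edges (induced (tri_graph n) U) = {(j, i). i \<le> j \<and> j \<in> U}"
    using U by (auto simp: induced_def)
  show "edges (induced (tri_graph n) U) \<subseteq> edges (tri_graph n)" unfolding H using U by auto
  show "matching (induced (tri_graph n) U) ?M"
    unfolding matching_def H using inj_onD[OF inj_on_rank[OF fin]] by (auto intro!: inj_onI)
  fix e assume "e \<in> edges (induced (tri_graph n) U) - ?M"
  then obtain j i where e: "e = (j, i)" "i \<le> j" "j \<in> U" "sample_rank U j \<noteq> i"
    unfolding H by auto
  have jn: "j < n" using e U by auto
  show "\<exists>f\<in>?M. (fst f = fst e \<or> snd f = snd e) \<and> weight (tri_graph n) e < weight (tri_graph n) f"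
  proof (cases "sample_rank U j < i")
    case True
    then show ?thesis using e jn weight_tri_graph_less[of j n j "sample_rank U j" i]
      by (intro bexI[of _ "(j, sample_rank U j)"]) auto
  next
    case False
    let ?V = "{s \<in> U. j < s}"
    \<comment> \<open>More than \<open>i\<close> elements of \<open>U\<close> lie above
      \<open>j\<close>, so one of them has rank \<open>i\<close> among these, and its rank in
      \<open>U\<close> is the same.\<close>
    have "i \<in> sample_rank ?V ` ?V"
      unfolding sample_rank_image[OF finite_subset[OF _ fin, of ?V], simplified]
      using False e(4) by (simp add: sample_rank_def)
    then obtain s where s: "s \<in> U" "j < s" "sample_rank ?V s = i" by auto
    have "{t \<in> ?V. s < t} = {t \<in> U. s < t}" using s(2) by auto
    then have "sample_rank U s = i" using s(3) by (simp add: sample_rank_def)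
    then show ?thesis using e s jn U weight_tri_graph_less[of j n s i i]
      by (intro bexI[of _ "(s, i)"]) auto
  qed
qed

text \<open>The first offer for a right vertex is always accepted, so the arrival order decides who
  wins it but not whether it is covered.\<close>

lemma alg_output_tri_graph:
  assumes es: "edge_order (tri_graph n) es" and S: "S \<subseteq> {..<n}" and vs: "set vs \<subseteq> {..<n} - S"
  defines "M \<equiv> alg_output (tri_graph n) es S vs"
  shows "M \<subseteq> edges (tri_graph n) \<and> inj_on snd M \<and>
    snd ` M = sample_rank S ` {u \<in> set vs. sample_rank S u \<le> u}"
  using vs unfolding M_def
proof (induction vs rule: rev_induct)
  case Nil
  then show ?case by (simp add: alg_output_def)
next
  case (snoc u vs)
  let ?M = "alg_output (tri_graph n) es S vs"
  have u: "u < n" "u \<notin> S" using snoc.prems by auto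
  \<comment> \<open>Ranks count larger elements only, so adding \<open>u\<close> does not change its
    own rank and the offer is determined by \<open>S\<close>.\<close>
  have "(u, r) \<in> greedy es (induced (tri_graph n) (insert u S)) \<longleftrightarrow>
      r = sample_rank S u \<and> sample_rank S u \<le> u" for r
  proof -
    have "insert u S \<subseteq> {..<n}" using S u by simp
    from greedy_tri_graph[OF es this] show ?thesis by auto
  qed
  then have step: "alg_output (tri_graph n) es S (vs @ [u]) = ?M \<union>
      (if sample_rank S u \<le> u \<and> sample_rank S u \<notin> snd ` ?M then {(u, sample_rank S u)} else {})"
    by (auto simp: alg_output_def alg_step_def)
  have IH: "?M \<subseteq> edges (tri_graph n)" "inj_on snd ?M"
    "snd ` ?M = sample_rank S ` {u \<in> set vs. sample_rank S u \<le> u}"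
    using snoc by auto
  have set: "{v \<in> set (vs @ [u]). sample_rank S v \<le> v} =
    {v \<in> set vs. sample_rank S v \<le> v} \<union> (if sample_rank S u \<le> u then {u} else {})" by auto
  show ?case unfolding step set image_Un IH(3)[symmetric] using IH(1,2) u by auto
qed

definition num_gained :: "nat \<Rightarrow> nat set \<Rightarrow> nat" where
  "num_gained n S = card {u \<in> {..<n}. u \<notin> S \<and> sample_rank S u \<le> u \<and> (Suc u = n \<or> Suc u \<in> S)}"

text \<open>
  The vertices competing for a fixed right vertex form a maximal interval of unsampled vertices,
  which is counted by its upper end.
\<close>

lemma card_rank_image:
  assumes S: "S \<subseteq> {..<n}"
  shows "card (sample_rank S ` {u \<in> {..<n} - S. sample_rank S u \<le> u}) = num_gained n S"
proof -
  have fin: "finite S" using S finite_subset by blast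
  let ?B = "{u \<in> {..<n} - S. sample_rank S u \<le> u}"
  let ?C = "{u \<in> {..<n}. u \<notin> S \<and> sample_rank S u \<le> u \<and> (Suc u = n \<or> Suc u \<in> S)}"
  have "sample_rank S u \<in> sample_rank S ` ?C" if "u \<in> ?B" for u
    using that
  \<comment> \<open>Climbing through unsampled vertices preserves the rank until the upper end of
    the interval is reached.\<close>
  proof (induction "n - u" arbitrary: u rule: less_induct)
    case less
    show ?case
    proof (cases "Suc u = n \<or> Suc u \<in> S")
      case True
      then show ?thesis using less.prems by blast
    next
      case False
      then have "sample_rank S u = sample_rank S (Suc u)" using sample_rank_Suc[OF fin, of u] by simp
      moreover have "sample_rank S (Suc u) \<in> sample_rank S ` ?C"
        using less.prems False calculation by (intro less.hyps) auto
      ultimately show ?thesis by simp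
    qed
  qed
  then have "sample_rank S ` ?B = sample_rank S ` ?C" by blast
  moreover have "inj_on (sample_rank S) ?C"
  proof (rule linorder_inj_onI)
    fix u v assume uv: "u < v" "u \<in> ?C" "v \<in> ?C"
    \<comment> \<open>The larger \<open>v\<close> rules out \<open>Suc u = n\<close>; the sampled
      \<open>Suc u\<close> then makes the rank drop strictly.\<close>
    then have "Suc u \<in> S" by auto
    then have "sample_rank S (Suc u) < sample_rank S u" using fin by (intro sample_rank_less) auto
    moreover have "sample_rank S v \<le> sample_rank S (Suc u)" using uv fin by (intro sample_rank_mono) auto
    ultimately show "sample_rank S u \<noteq> sample_rank S v" by simp
  qed auto
  ultimately show ?thesis by (simp add: card_image num_gained_def)
qed

lemma alg_value_tri_graph:
  assumes "edge_order (tri_graph n) es" "S \<subseteq> {..<n}" "vs \<in> permutations_of_set ({..<n} - S)"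
  shows "real (num_gained n S) \<le> alg_value (tri_graph n) es S vs"
    "alg_value (tri_graph n) es S vs \<le> real (num_gained n S) + 1"
proof -
  let ?M = "alg_output (tri_graph n) es S vs"
  have set: "set vs = {..<n} - S" using assms(3) by (rule permutations_of_setD)
  have M: "?M \<subseteq> edges (tri_graph n)" "inj_on snd ?M"
    "snd ` ?M = sample_rank S ` {u \<in> {..<n} - S. sample_rank S u \<le> u}"
    using alg_output_tri_graph[OF assms(1,2), of vs] set by auto
  have "card ?M = num_gained n S"
    using card_image[OF M(2)] card_rank_image[OF assms(2)] M(3) by simp
  then show "real (num_gained n S) \<le> alg_value (tri_graph n) es S vs"
    "alg_value (tri_graph n) es S vs \<le> real (num_gained n S) + 1"
    using weight_sum_tri_graph[OF M(1,2)] by (simp_all add: alg_value_def)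
qed

section \<open>The law of the sample and expectations over it\<close>

text \<open>For finite \<open>A\<close> and \<open>p\<close> in \<open>[0, 1]\<close>: expectation
  over a random subset containing each element of \<open>A\<close> independently with probability
  \<open>p\<close>.\<close>

definition sample_expectation :: "real \<Rightarrow> 'a set \<Rightarrow> ('a set \<Rightarrow> real) \<Rightarrow> real" where
  "sample_expectation p A g = (\<Sum>S\<in>Pow A. p ^ card S * (1 - p) ^ (card A - card S) * g S)"

text \<open>Such a permutation is an arrangement of \<open>S\<close> followed by one of
  \<open>A - S\<close>.\<close>

lemma card_permutations_prefix:
  assumes "finite A" "S \<subseteq> A"
  shows "card {vs \<in> permutations_of_set A. set (take (card S) vs) = S} =
    fact (card S) * fact (card A - card S)"
proof -
  have fin: "finite S" using assms finite_subset by blast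
  have "bij_betw (\<lambda>(xs, ys). xs @ ys) (permutations_of_set S \<times> permutations_of_set (A - S))
    {vs \<in> permutations_of_set A. set (take (card S) vs) = S}"
  proof (rule bij_betwI[where g = "\<lambda>vs. (take (card S) vs, drop (card S) vs)"])
    show "(\<lambda>(xs, ys). xs @ ys) \<in> permutations_of_set S \<times> permutations_of_set (A - S) \<rightarrow>
      {vs \<in> permutations_of_set A. set (take (card S) vs) = S}"
      using assms by (auto simp: permutations_of_set_def distinct_card)
    show "(\<lambda>vs. (take (card S) vs, drop (card S) vs)) \<in>
      {vs \<in> permutations_of_set A. set (take (card S) vs) = S} \<rightarrow>
      permutations_of_set S \<times> permutations_of_set (A - S)"
    proof
      fix vs assume "vs \<in> {vs \<in> permutations_of_set A. set (take (card S) vs) = S}"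
      then have vs: "set vs = A" "distinct vs" "set (take (card S) vs) = S"
        by (auto simp: permutations_of_set_def)
      have "set (take (card S) vs) \<union> set (drop (card S) vs) = A"
        using vs(1) by (metis append_take_drop_id set_append)
      moreover have "set (take (card S) vs) \<inter> set (drop (card S) vs) = {}"
        using vs(2) by (metis append_take_drop_id distinct_append)
      ultimately have "set (drop (card S) vs) = A - S" using vs(3) by auto
      then show "(take (card S) vs, drop (card S) vs) \<in>
        permutations_of_set S \<times> permutations_of_set (A - S)"
        using vs by (auto simp: permutations_of_set_def)
    qed
  qed (auto simp: permutations_of_set_def distinct_card)
  then have "card {vs \<in> permutations_of_set A. set (take (card S) vs) = S} =
    card (permutations_of_set S \<times> permutations_of_set (A - S))"
    by (simp add: bij_betw_same_card)
  then show ?thesis using assms fin by (simp add: card_cartesian_product card_Diff_subset)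
qed

lemma set_pmf_random_arrivals:
  assumes "finite A"
  shows "set_pmf (random_arrivals p A) \<subseteq> (SIGMA S:Pow A. permutations_of_set (A - S))"
proof -
  have "(set (take k vs), drop k vs) \<in> (SIGMA S:Pow A. permutations_of_set (A - S))"
    if "vs \<in> permutations_of_set A" for k vs
  proof -
    have vs: "set vs = A" "distinct vs" using that by (auto simp: permutations_of_set_def)
    have "set (take k vs) \<union> set (drop k vs) = A"
      using vs(1) by (metis append_take_drop_id set_append)
    moreover have "set (take k vs) \<inter> set (drop k vs) = {}"
      using vs(2) by (metis append_take_drop_id distinct_append)
    ultimately show ?thesis using vs(2) by (auto simp: permutations_of_set_def)
  qed
  then show ?thesis using assms by (auto simp: random_arrivals_def)
qed

text \<open>All sets of size \<open>k\<close> are equally likely as the prefix of length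
  \<open>k\<close>, which cancels the binomial coefficient of the binomial law.\<close>

lemma pmf_random_sample:
  assumes A: "finite A" "S \<subseteq> A" and p: "0 \<le> p" "p \<le> 1"
  shows "pmf (map_pmf fst (random_arrivals p A)) S = p ^ card S * (1 - p) ^ (card A - card S)"
proof -
  let ?n = "card A" and ?k = "card S"
  let ?P = "\<lambda>k. map_pmf (\<lambda>vs. set (take k vs)) (pmf_of_set (permutations_of_set A))"
  have kn: "?k \<le> ?n" using A by (simp add: card_mono)
  have eq: "map_pmf fst (random_arrivals p A) = bind_pmf (binomial_pmf ?n p) ?P"
    by (simp add: random_arrivals_def map_bind_pmf map_pmf_def bind_assoc_pmf bind_return_pmf)
  have P: "pmf (?P k) S = indicator {?k} k / real (?n choose ?k)"
    if "k \<in> set_pmf (binomial_pmf ?n p)" for k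
  proof -
    \<comment> \<open>On the support, a prefix of length \<open>k\<close> has exactly
      \<open>k\<close> elements, so only \<open>k = card S\<close> contributes.\<close>
    have "k \<le> ?n" using that p set_pmf_binomial_eq[of p ?n] by (auto split: if_splits)
    have "pmf (?P k) S = real (card {vs \<in> permutations_of_set A. set (take k vs) = S}) / fact ?n"
      using A(1) by (simp add: pmf_map measure_pmf_of_set vimage_def Int_def)
    also have "\<dots> = indicator {?k} k / real (?n choose ?k)"
    proof (cases "k = ?k")
      case True
      then show ?thesis using A kn by (simp add: card_permutations_prefix binomial_fact)
    next
      case False
      have "{vs \<in> permutations_of_set A. set (take k vs) = S} = {}"
      proof -
        have "card S = k" if "set vs = A" "distinct vs" "set (take k vs) = S" for vs
          using that \<open>k \<le> ?n\<close> distinct_card[of vs] distinct_card[of "take k vs"] by auto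
        then show ?thesis using False by (auto simp: permutations_of_set_def)
      qed
      then show ?thesis using False by simp
    qed
    finally show ?thesis .
  qed
  have "pmf (map_pmf fst (random_arrivals p A)) S =
    measure_pmf.expectation (binomial_pmf ?n p) (\<lambda>k. pmf (?P k) S)"
    unfolding eq pmf_bind ..
  also have "\<dots> = measure_pmf.expectation (binomial_pmf ?n p)
      (\<lambda>k. indicator {?k} k / real (?n choose ?k))"
    by (intro integral_cong_AE) (auto simp: AE_measure_pmf_iff P)
  also have "\<dots> = pmf (binomial_pmf ?n p) ?k / real (?n choose ?k)"
    by (simp add: measure_pmf_single)
  also have "\<dots> = p ^ ?k * (1 - p) ^ (?n - ?k)"
    using p kn by simp
  finally show ?thesis .
qed

lemma expectation_random_sample:
  assumes "finite A" "0 \<le> p" "p \<le> 1"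
  shows "measure_pmf.expectation (map_pmf fst (random_arrivals p A)) g = sample_expectation p A g"
proof -
  have "set_pmf (map_pmf fst (random_arrivals p A)) \<subseteq> Pow A"
    using set_pmf_random_arrivals[OF assms(1)] by fastforce
  then have "measure_pmf.expectation (map_pmf fst (random_arrivals p A)) g =
    (\<Sum>S\<in>Pow A. g S * pmf (map_pmf fst (random_arrivals p A)) S)"
    using assms(1) by (intro integral_measure_pmf_real) auto
  also have "\<dots> = sample_expectation p A g"
    unfolding sample_expectation_def using assms
    by (intro sum.cong) (simp_all add: pmf_random_sample mult.commute)
  finally show ?thesis .
qed

lemma sample_expectation_const:
  assumes "finite A" "0 \<le> p" "p \<le> 1"
  shows "sample_expectation p A (\<lambda>_. c) = c"
  using expectation_random_sample[OF assms, of "\<lambda>_. c"] by simp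

lemma sample_expectation_mono:
  assumes "0 \<le> p" "p \<le> 1" "\<And>S. S \<subseteq> A \<Longrightarrow> f S \<le> g S"
  shows "sample_expectation p A f \<le> sample_expectation p A g"
  unfolding sample_expectation_def using assms
  by (intro sum_mono mult_left_mono) auto

lemma sample_expectation_add:
  "sample_expectation p A (\<lambda>S. f S + g S) = sample_expectation p A f + sample_expectation p A g"
  by (simp add: sample_expectation_def distrib_left sum.distrib)

lemma sample_expectation_sum:
  "sample_expectation p A (\<lambda>S. \<Sum>i\<in>I. f i S) = (\<Sum>i\<in>I. sample_expectation p A (f i))"
  unfolding sample_expectation_def sum_distrib_left by (rule sum.swap)

text \<open>Subsets are split by membership of \<open>u\<close>, that is, by conditioning on whether
  \<open>u\<close> is sampled.\<close>

lemma sample_expectation_insert: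
  assumes "finite B" "u \<notin> B"
  shows "sample_expectation p (insert u B) g =
    p * sample_expectation p B (\<lambda>S. g (insert u S)) + (1 - p) * sample_expectation p B g"
proof -
  let ?t = "\<lambda>S. p ^ card S * (1 - p) ^ (card (insert u B) - card S) * g S"
  have inj: "inj_on (insert u) (Pow B)" using assms(2) by (auto intro!: inj_onI)
  have "sample_expectation p (insert u B) g = sum ?t (Pow B \<union> insert u ` Pow B)"
    unfolding sample_expectation_def Pow_insert ..
  also have "\<dots> = sum ?t (Pow B) + sum ?t (insert u ` Pow B)"
    using assms by (intro sum.union_disjoint) auto
  also have "sum ?t (Pow B) = (1 - p) * sample_expectation p B g"
    unfolding sample_expectation_def sum_distrib_left
  proof (intro sum.cong refl)
    fix S assume "S \<in> Pow B"
    then have "card S \<le> card B" using assms by (simp add: card_mono)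
    then show "?t S = (1 - p) * (p ^ card S * (1 - p) ^ (card B - card S) * g S)"
      using assms by (simp add: Suc_diff_le)
  qed
  also have "sum ?t (insert u ` Pow B) = p * sample_expectation p B (\<lambda>S. g (insert u S))"
    unfolding sample_expectation_def sum_distrib_left sum.reindex[OF inj] comp_def
  proof (intro sum.cong refl)
    fix S assume "S \<in> Pow B"
    then have "finite S" "u \<notin> S" using assms finite_subset by auto
    then show "?t (insert u S) = p * (p ^ card S * (1 - p) ^ (card B - card S) * g (insert u S))"
      using assms by simp
  qed
  finally show ?thesis by simp
qed

lemma sample_expectation_indep:
  assumes "finite A" "u \<in> A" "\<And>S. h (insert u S) = h S"
  shows "sample_expectation p A (\<lambda>S. of_bool (u \<in> S) * h S) = p * sample_expectation p A h"
    "sample_expectation p A (\<lambda>S. of_bool (u \<notin> S) * h S) = (1 - p) * sample_expectation p A h"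
proof -
  obtain B where B: "A = insert u B" "u \<notin> B" "finite B"
    using assms(1,2) by (metis mk_disjoint_insert finite_insert)
  let ?E = "sample_expectation p B h"
  have "sample_expectation p B (\<lambda>S. of_bool (u \<in> S) * h S) = 0"
    "sample_expectation p B (\<lambda>S. of_bool (u \<notin> S) * h S) = ?E"
    unfolding sample_expectation_def using B(2)
    by (auto intro!: sum.neutral sum.cong)
  moreover have "sample_expectation p B (\<lambda>S. 0) = 0" by (simp add: sample_expectation_def)
  ultimately show "sample_expectation p A (\<lambda>S. of_bool (u \<in> S) * h S) = p * sample_expectation p A h"
    "sample_expectation p A (\<lambda>S. of_bool (u \<notin> S) * h S) = (1 - p) * sample_expectation p A h"
    using B(2,3) unfolding B(1)
    by (simp_all add: sample_expectation_insert assms(3) algebra_simps)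
qed

text \<open>Linearity over \<open>u\<close> reduces this to \<open>sample_expectation_indep\<close>.
  It suits conditions on \<open>u\<close> that look only at vertices above \<open>u\<close>.\<close>

lemma sample_expectation_card:
  assumes "finite A" "\<And>u S. P u (insert u S) = P u S"
  shows "sample_expectation p A (\<lambda>S. real (card {u \<in> A. u \<in> S \<and> P u S})) =
      p * sample_expectation p A (\<lambda>S. real (card {u \<in> A. P u S}))"
    "sample_expectation p A (\<lambda>S. real (card {u \<in> A. u \<notin> S \<and> P u S})) =
      (1 - p) * sample_expectation p A (\<lambda>S. real (card {u \<in> A. P u S}))"
proof -
  have card: "real (card {u \<in> A. Q u}) = (\<Sum>u\<in>A. of_bool (Q u))" for Q
    using assms(1) by (simp add: Int_def)
  show "sample_expectation p A (\<lambda>S. real (card {u \<in> A. u \<in> S \<and> P u S})) =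
      p * sample_expectation p A (\<lambda>S. real (card {u \<in> A. P u S}))"
    "sample_expectation p A (\<lambda>S. real (card {u \<in> A. u \<notin> S \<and> P u S})) =
      (1 - p) * sample_expectation p A (\<lambda>S. real (card {u \<in> A. P u S}))"
    unfolding card sample_expectation_sum of_bool_conj sum_distrib_left
    using assms by (auto intro!: sum.cong sample_expectation_indep)
qed

section \<open>The expected number of gained right vertices\<close>

text \<open>All three counts are read off from the threshold \<open>T\<close>: \<open>N\<close> is
  \<open>n - T\<close>, while \<open>m\<close> and \<open>g\<close> both equal the number of sampled
  vertices above \<open>T\<close>, up to one.\<close>

lemma card_rank_bounds:
  assumes S: "S \<subseteq> {..<n}" and n: "0 < n"
  defines "N \<equiv> card {u \<in> {..<n}. sample_rank S u \<le> u}"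
    and "m \<equiv> card {u \<in> {..<n}. u \<in> S \<and> sample_rank S u \<le> u}"
    and "g \<equiv> card {u \<in> {..<n}. sample_rank S u \<le> u \<and> (Suc u = n \<or> Suc u \<in> S)}"
  shows "n \<le> m + N" "m + N \<le> n + 1" "m \<le> g" "g \<le> m + 1"
proof -
  have fin: "finite S" using S finite_subset by blast
  define T where "T = (LEAST u. sample_rank S u \<le> u)"
  \<comment> \<open>The last vertex has rank \<open>0\<close>, so \<open>T\<close> is well defined
    and below \<open>n\<close>.\<close>
  have "{s \<in> S. n - 1 < s} = {}" using S by auto
  then have "sample_rank S (n - 1) = 0" unfolding sample_rank_def by (simp only: card.empty)
  then have last: "sample_rank S (n - 1) \<le> n - 1" by simp
  have T: "sample_rank S T \<le> T" "T \<le> n - 1"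
    using last unfolding T_def by (rule LeastI, rule Least_le)
  have iff: "sample_rank S u \<le> u \<longleftrightarrow> T \<le> u" for u
  proof
    show "T \<le> u" if "sample_rank S u \<le> u" using that unfolding T_def by (rule Least_le)
    show "sample_rank S u \<le> u" if "T \<le> u"
      using sample_rank_mono[OF fin that] that T(1) by linarith
  qed
  have N: "N = n - T"
  proof -
    have "{u \<in> {..<n}. sample_rank S u \<le> u} = {T..<n}" by (auto simp: iff)
    then show ?thesis by (simp add: N_def)
  qed
  have m: "m = sample_rank S T + of_bool (T \<in> S)"
  proof -
    have "{u \<in> {..<n}. u \<in> S \<and> sample_rank S u \<le> u} =
        {s \<in> S. T < s} \<union> (if T \<in> S then {T} else {})"
      using S by (auto simp: iff intro: le_neq_implies_less)
    then show ?thesis using fin by (simp add: m_def sample_rank_def)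
  qed
  have g: "g = sample_rank S T + 1"
  proof -
    \<comment> \<open>Successors of the counted vertices are the sampled vertices above
      \<open>T\<close>; the last vertex contributes the artificial successor \<open>n\<close>,
      whence the \<open>+ 1\<close> in \<open>g\<close>.\<close>
    have "bij_betw Suc {u \<in> {..<n}. sample_rank S u \<le> u \<and> (Suc u = n \<or> Suc u \<in> S)}
        (insert n {s \<in> S. T < s})"
    proof (rule bij_betw_imageI)
      have "s \<in> Suc ` {u \<in> {..<n}. sample_rank S u \<le> u \<and> (Suc u = n \<or> Suc u \<in> S)}"
        if "s \<in> insert n {s \<in> S. T < s}" for s
        using that S T(2) n by (intro image_eqI[of _ _ "s - 1"]) (auto simp: iff)
      then show "Suc ` {u \<in> {..<n}. sample_rank S u \<le> u \<and> (Suc u = n \<or> Suc u \<in> S)} =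
          insert n {s \<in> S. T < s}"
        by (auto simp: iff less_Suc_eq_le)
    qed simp
    then have "g = card (insert n {s \<in> S. T < s})"
      unfolding g_def by (rule bij_betw_same_card)
    moreover have "n \<notin> S" using S by auto
    ultimately show ?thesis using fin by (simp add: sample_rank_def)
  qed
  have lower: "T \<le> m"
  proof (cases T)
    case (Suc t)
    \<comment> \<open>By minimality of \<open>T\<close>, more than \<open>t\<close> sampled vertices
      lie above \<open>t\<close>, and these are the ones counted by \<open>m\<close>.\<close>
    then have "t < sample_rank S t" using iff[of t] by linarith
    then show ?thesis using sample_rank_Suc[OF fin, of t] Suc m by simp
  qed simp
  show "n \<le> m + N" "m + N \<le> n + 1" "m \<le> g" "g \<le> m + 1"
    using lower T n m N g by auto
qed

text \<open>Independence turns \<open>m + N\<close> into \<open>(1 + p) * N\<close> in expectation,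
  which pins down the mean of \<open>N\<close>, then that of \<open>m\<close>, and up to
  \<open>1\<close> that of \<open>g\<close>.\<close>

lemma sample_expectation_num_gained:
  assumes p: "0 \<le> p" "p \<le> 1" and n: "0 < n"
  defines "c \<equiv> p * (1 - p) / (1 + p)"
  shows "c * real n \<le> sample_expectation p {..<n} (\<lambda>S. real (num_gained n S))"
    "sample_expectation p {..<n} (\<lambda>S. real (num_gained n S)) \<le> c * real n + 2"
proof -
  let ?E = "sample_expectation p {..<n} :: (nat set \<Rightarrow> real) \<Rightarrow> real"
  let ?N = "\<lambda>S. real (card {u \<in> {..<n}. sample_rank S u \<le> u})"
    and ?m = "\<lambda>S. real (card {u \<in> {..<n}. u \<in> S \<and> sample_rank S u \<le> u})"
    and ?g = "\<lambda>S. real (card {u \<in> {..<n}. sample_rank S u \<le> u \<and> (Suc u = n \<or> Suc u \<in> S)})"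
    and ?f = "\<lambda>S. real (num_gained n S)"
  have m: "?E ?m = p * ?E ?N" by (rule sample_expectation_card) auto
  \<comment> \<open>The conditions counted by \<open>?g\<close> involve only vertices above
    \<open>u\<close>, so being unsampled splits off as a factor.\<close>
  have f: "?E ?f = (1 - p) * ?E ?g"
    unfolding num_gained_def by (rule sample_expectation_card) auto
  note const = sample_expectation_const[OF finite_lessThan p]
  have bounds: "real n \<le> ?m S + ?N S" "?m S + ?N S \<le> real n + 1" "?m S \<le> ?g S" "?g S \<le> ?m S + 1"
    if "S \<subseteq> {..<n}" for S
    using card_rank_bounds[OF that n] by linarith+
  have "?E (\<lambda>S. real n) \<le> ?E (\<lambda>S. ?m S + ?N S)"
    by (intro sample_expectation_mono p bounds)
  then have 1: "real n \<le> (1 + p) * ?E ?N"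
    unfolding sample_expectation_add m const by (simp add: algebra_simps)
  have "?E (\<lambda>S. ?m S + ?N S) \<le> ?E (\<lambda>S. real n + 1)"
    by (intro sample_expectation_mono p bounds)
  then have 2: "(1 + p) * ?E ?N \<le> real n + 1"
    unfolding sample_expectation_add m const by (simp add: algebra_simps)
  have 3: "?E ?m \<le> ?E ?g"
    by (intro sample_expectation_mono p bounds)
  have "?E ?g \<le> ?E (\<lambda>S. ?m S + 1)"
    by (intro sample_expectation_mono p bounds)
  then have 4: "?E ?g \<le> ?E ?m + 1"
    unfolding sample_expectation_add const .
  have c: "c * ((1 + p) * x) = (1 - p) * (p * x)" for x
    using p by (simp add: c_def)
  have "c * real n \<le> c * ((1 + p) * ?E ?N)"
    using 1 p by (intro mult_left_mono) (auto simp: c_def)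
  also have "\<dots> = (1 - p) * ?E ?m" unfolding m c ..
  also have "\<dots> \<le> ?E ?f" unfolding f using 3 p by (intro mult_left_mono) auto
  finally show "c * real n \<le> ?E ?f" .
  have c1: "c \<le> 1"
  proof -
    have "p * (1 - p) \<le> 1 * (1 + p)" using p by (intro mult_mono) auto
    then show ?thesis using p by (simp add: c_def)
  qed
  have "?E ?f \<le> (1 - p) * (?E ?m + 1)" unfolding f using 4 p by (intro mult_left_mono) auto
  also have "\<dots> = c * ((1 + p) * ?E ?N) + (1 - p)" unfolding m c by (simp add: distrib_left)
  also have "\<dots> \<le> c * (real n + 1) + (1 - p)"
    using 2 p by (intro add_right_mono mult_left_mono) (auto simp: c_def)
  \<comment> \<open>The two error terms, \<open>c\<close> and \<open>1 - p\<close>, are each at most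
    \<open>1\<close>.\<close>
  also have "\<dots> \<le> c * real n + 2" using c1 p by (simp add: algebra_simps)
  finally show "?E ?f \<le> c * real n + 2" .
qed

section \<open>Expected weight and the limiting ratio\<close>

text \<open>For each sample and every order of the rest, the value is within \<open>1\<close> of
  \<open>num_gained\<close>, so only the marginal law of the sample matters. The \<open>3\<close> is
  the earlier \<open>2\<close> plus this \<open>1\<close>.\<close>

lemma expected_alg_tri_graph:
  assumes p: "0 \<le> p" "p \<le> 1" and n: "0 < n" and es: "edge_order (tri_graph n) es"
    and marginal: "map_pmf fst D = map_pmf fst (random_arrivals p {..<n})"
    and supp: "set_pmf D \<subseteq> (SIGMA S:Pow {..<n}. permutations_of_set ({..<n} - S))"
  defines "c \<equiv> p * (1 - p) / (1 + p)"
  shows "c * real n \<le> expected_alg (tri_graph n) es D"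
    "expected_alg (tri_graph n) es D \<le> c * real n + 3"
proof -
  have "finite (set_pmf D)"
    by (rule finite_subset[OF supp]) auto
  then have int: "integrable (measure_pmf D) f" for f :: "_ \<Rightarrow> real"
    by (rule integrable_measure_pmf_finite)
  let ?F = "\<lambda>x. real (num_gained n (fst x))"
  have "measure_pmf.expectation D ?F =
    measure_pmf.expectation (map_pmf fst D) (\<lambda>S. real (num_gained n S))"
    by simp
  also have "\<dots> = sample_expectation p {..<n} (\<lambda>S. real (num_gained n S))"
    unfolding marginal using p by (intro expectation_random_sample) auto
  finally have F: "c * real n \<le> measure_pmf.expectation D ?F"
    "measure_pmf.expectation D ?F \<le> c * real n + 2"
    using sample_expectation_num_gained[OF p n] unfolding c_def by auto
  let ?V = "\<lambda>(S, vs). alg_value (tri_graph n) es S vs"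
  have val: "?F x \<le> ?V x" "?V x \<le> ?F x + 1" if "x \<in> set_pmf D" for x
  proof -
    have "x \<in> (SIGMA S:Pow {..<n}. permutations_of_set ({..<n} - S))"
      using supp that by (rule subsetD)
    then obtain S vs where "x = (S, vs)" "S \<subseteq> {..<n}" "vs \<in> permutations_of_set ({..<n} - S)"
      by (elim SigmaE) simp
    then show "?F x \<le> ?V x" "?V x \<le> ?F x + 1"
      using alg_value_tri_graph[OF es] by simp_all
  qed
  have "measure_pmf.expectation D ?F \<le> expected_alg (tri_graph n) es D"
    unfolding expected_alg_def by (intro integral_mono_AE int) (simp add: AE_measure_pmf_iff val)
  then show "c * real n \<le> expected_alg (tri_graph n) es D" using F by linarith
  have "expected_alg (tri_graph n) es D \<le> measure_pmf.expectation D (\<lambda>x. ?F x + 1)"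
    unfolding expected_alg_def by (intro integral_mono_AE int) (simp add: AE_measure_pmf_iff val)
  also have "\<dots> = measure_pmf.expectation D ?F + 1"
    by (subst Bochner_Integration.integral_add[OF int int]) simp
  finally show "expected_alg (tri_graph n) es D \<le> c * real n + 3" using F by linarith
qed

lemma ratio_tendsto:
  fixes c :: real
  assumes "0 \<le> c"
    and a: "\<And>k. c * real (Suc k) \<le> a k" "\<And>k. a k \<le> c * real (Suc k) + 3"
    and b: "\<And>k. real (Suc k) \<le> b k" "\<And>k. b k \<le> real (Suc k) + 1"
  shows "(\<lambda>k. a k / b k) \<longlonglongrightarrow> c"
proof (rule tendsto_sandwich)
  have pos: "0 < b k" for k using b(1)[of k] by simp
  show "\<forall>\<^sub>F k in sequentially. c * real (Suc k) / (real (Suc k) + 1) \<le> a k / b k"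
    using assms pos by (intro always_eventually allI frac_le) (auto intro: order_trans[OF _ a(1)])
  show "\<forall>\<^sub>F k in sequentially. a k / b k \<le> (c * real (Suc k) + 3) / real (Suc k)"
    using assms pos by (intro always_eventually allI frac_le) auto
  show "(\<lambda>k. c * real (Suc k) / (real (Suc k) + 1)) \<longlonglongrightarrow> c"
    by real_asymp
  show "(\<lambda>k. (c * real (Suc k) + 3) / real (Suc k)) \<longlonglongrightarrow> c"
    by real_asymp
qed

theorem theorem2p8:
  fixes p :: real
  assumes "0 \<le> p" and "p \<le> 1"
  shows "\<exists>G :: nat \<Rightarrow> (nat, nat) wgraph.
    (\<forall>k. wf_wgraph (G k) \<and> opt (G k) > 0) \<and>
    strict_mono (\<lambda>k. num_vertices (G k)) \<and>
    (\<forall>es. (\<forall>k. edge_order (G k) (es k)) \<longrightarrow>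
      (\<lambda>k. expected_alg (G k) (es k) (random_arrivals p (left (G k))) / opt (G k))
        \<longlonglongrightarrow> p * (1 - p) / (1 + p) \<and>
      (\<forall>\<sigma>. (\<forall>k. arrival_rule (left (G k)) (\<sigma> k)) \<longrightarrow>
        (\<lambda>k. expected_alg (G k) (es k) (adversarial_arrivals p (left (G k)) (\<sigma> k)) / opt (G k))
          \<longlonglongrightarrow> p * (1 - p) / (1 + p)))"
proof (intro exI[of _ "\<lambda>k. tri_graph (Suc k)"] conjI allI impI)
  fix k
  show "wf_wgraph (tri_graph (Suc k))" by (rule wf_tri_graph)
  \<comment> \<open>Starting at size \<open>Suc k\<close> avoids the empty graph, whose optimum is
    \<open>0\<close>.\<close>
  show "opt (tri_graph (Suc k)) > 0" using opt_tri_graph(1)[of "Suc k"] by simp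
next
  show "strict_mono (\<lambda>k. num_vertices (tri_graph (Suc k)))"
    by (rule strict_monoI) (simp add: num_vertices_def)
next
  have c: "0 \<le> p * (1 - p) / (1 + p)" using assms by simp
  fix es assume es: "\<forall>k. edge_order (tri_graph (Suc k)) (es k)"
  let ?A = "\<lambda>k. left (tri_graph (Suc k))"
  note bounds = expected_alg_tri_graph[OF assms zero_less_Suc es[rule_format]]
  show "(\<lambda>k. expected_alg (tri_graph (Suc k)) (es k) (random_arrivals p (?A k)) /
      opt (tri_graph (Suc k))) \<longlonglongrightarrow> p * (1 - p) / (1 + p)"
    by (intro ratio_tendsto c opt_tri_graph bounds) (simp_all add: set_pmf_random_arrivals)
  fix \<sigma> assume \<sigma>: "\<forall>k. arrival_rule (?A k) (\<sigma> k)"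
  \<comment> \<open>The adversary's order is drawn after the sample, so forgetting it leaves the law
    of the sample intact.\<close>
  have marginal: "map_pmf fst (adversarial_arrivals p A \<tau>) = map_pmf fst (random_arrivals p A)"
    for A :: "nat set" and \<tau>
    unfolding adversarial_arrivals_def
    by (simp add: map_bind_pmf bind_return_pmf')
  have supp: "set_pmf (adversarial_arrivals p A \<tau>) \<subseteq> (SIGMA S:Pow A. permutations_of_set (A - S))"
    if "finite A" "arrival_rule A \<tau>" for A :: "nat set" and \<tau>
  proof -
    have sub: "fst ` set_pmf (random_arrivals p A) \<subseteq> Pow A"
      by (auto dest!: subsetD[OF set_pmf_random_arrivals[OF that(1)]])
    have "set_pmf (adversarial_arrivals p A \<tau>) =
        (SIGMA S:fst ` set_pmf (random_arrivals p A). set_pmf (\<tau> S))"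
      by (auto simp: adversarial_arrivals_def)
    also have "\<dots> \<subseteq> (SIGMA S:Pow A. permutations_of_set (A - S))"
    proof (rule Sigma_mono[OF sub])
      fix S assume "S \<in> fst ` set_pmf (random_arrivals p A)"
      then have "S \<subseteq> A" using sub by blast
      then show "set_pmf (\<tau> S) \<subseteq> permutations_of_set (A - S)"
        using that(2) by (simp add: arrival_rule_def)
    qed
    finally show ?thesis .
  qed
  show "(\<lambda>k. expected_alg (tri_graph (Suc k)) (es k) (adversarial_arrivals p (?A k) (\<sigma> k)) /
      opt (tri_graph (Suc k))) \<longlonglongrightarrow> p * (1 - p) / (1 + p)"
  proof (intro ratio_tendsto c opt_tri_graph)
    fix k
    note D = marginal supp[OF finite_lessThan \<sigma>[rule_format, of k, unfolded tri_graph_simps]]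
    show "p * (1 - p) / (1 + p) * real (Suc k)
        \<le> expected_alg (tri_graph (Suc k)) (es k) (adversarial_arrivals p (?A k) (\<sigma> k))"
      "expected_alg (tri_graph (Suc k)) (es k) (adversarial_arrivals p (?A k) (\<sigma> k))
        \<le> p * (1 - p) / (1 + p) * real (Suc k) + 3"
      unfolding tri_graph_simps by (rule bounds[OF D])+
  qed
qed

end
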